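(* Let $p$ be a prime and let $W=C_p\wr\mathbb{Z}_p$ be the profinite wreath product. Then $\Delta_{\mathrm{virt}}(W)=\Gamma_{\mathrm{virt}}(W)\smallsetminus\{1\}$ (that is, the identity is the only isolated vertex of $\Gamma_{\mathrm{virt}}(W)$) and $\mathrm{diam}(\Delta_{\mathrm{virt}}(W))=2$.
   Context: For a topological group $G$, the virtually generating graph $\Gamma_{\mathrm{virt}}(G)$ has vertex set $G$, and two elements $x,y$ are adjacent if and only if the closed subgroup $\langle x,y\rangle$ they topologically generate is open in $G$. A vertex $x$ is isolated if there is no $y\in G$ with $\langle x,y\rangle$ open. The proper virtually generating graph $\Delta_{\mathrm{virt}}(G)$ is obtained from $\Gamma_{\mathrm{virt}}(G)$ by removing its isolated vertices. A statement about the diameter includes that the graph is connected. The profinite wreath product $C_p\wr\mathbb{Z}_p$ is the pro-$p$ group $\mathbb{F}_p[[X]]\rtimes\langle t\rangle$, where $\langle t\rangle\cong\mathbb{Z}_p$ and $t$ acts on the additive group $\mathbb{F}_p[[X]]$ by multiplication by $1+X$. *)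

theory Defs
  imports
    "HOL-Analysis.Analysis"
    "HOL-Algebra.Product_Groups"
    "Berlekamp_Zassenhaus.Finite_Field"
    "Graph_Theory.Graph_Theory"
begin

section \<open>Topological groups and the virtually generating graph\<close>

locale topological_group = group G for G (structure) +
  fixes T :: "'a topology"
  assumes topspace_eq: "topspace T = carrier G"
    and continuous_mult: "continuous_map (prod_topology T T) T (\<lambda>(x, y). x \<otimes> y)"
    and continuous_inv: "continuous_map T T (\<lambda>x. inv x)"

text \<open>The definitions below take the group and its topology as separate arguments and are meant
  for pairs that satisfy \<^locale>\<open>topological_group\<close>.\<close>

definition top_generate :: "('a, 'm) monoid_scheme \<Rightarrow> 'a topology \<Rightarrow> 'a set \<Rightarrow> 'a set" where
  "top_generate G T S = T closure_of (generate G S)"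

definition virt_generates :: "('a, 'm) monoid_scheme \<Rightarrow> 'a topology \<Rightarrow> 'a \<Rightarrow> 'a \<Rightarrow> bool" where
  "virt_generates G T x y \<longleftrightarrow> openin T (top_generate G T {x, y})"

text \<open>A simple graph is represented as a symmetric loop-free digraph, so a pair
  of adjacent vertices contributes one arc in each direction.\<close>

definition virt_graph :: "('a, 'm) monoid_scheme \<Rightarrow> 'a topology \<Rightarrow> ('a, 'a \<times> 'a) pre_digraph" where
  "virt_graph G T = with_proj
     \<lparr> pverts = carrier G,
       parcs = {(x, y). x \<in> carrier G \<and> y \<in> carrier G \<and> x \<noteq> y \<and> virt_generates G T x y} \<rparr>"

definition virt_isolated :: "('a, 'm) monoid_scheme \<Rightarrow> 'a topology \<Rightarrow> 'a set" where
  "virt_isolated G T = {x \<in> carrier G. \<not> (\<exists>y \<in> carrier G. virt_generates G T x y)}"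

definition proper_virt_graph ::
    "('a, 'm) monoid_scheme \<Rightarrow> 'a topology \<Rightarrow> ('a, 'a \<times> 'a) pre_digraph" where
  "proper_virt_graph G T = virt_graph G T \<restriction> (carrier G - virt_isolated G T)"

text \<open>Every arc has weight 1, so \<open>wf_digraph.\<mu>\<close> is the usual graph distance; it is
  \<open>\<infinity>\<close> between vertices in different components.\<close>

definition graph_diameter :: "('v, 'e) pre_digraph \<Rightarrow> ereal" where
  "graph_diameter \<Gamma> = (SUP u \<in> verts \<Gamma>. SUP v \<in> verts \<Gamma>. wf_digraph.\<mu> \<Gamma> (\<lambda>_. 1) u v)"

lemma virt_generates_commute: "virt_generates G T x y \<longleftrightarrow> virt_generates G T y x"
  by (simp add: virt_generates_def insert_commute)

lemma virt_graph_simps: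
  "verts (virt_graph G T) = carrier G"
  "arcs (virt_graph G T) =
     {(x, y). x \<in> carrier G \<and> y \<in> carrier G \<and> x \<noteq> y \<and> virt_generates G T x y}"
  "tail (virt_graph G T) = fst" "head (virt_graph G T) = snd"
  by (simp_all add: virt_graph_def)

lemma wf_digraph_virt_graph: "wf_digraph (virt_graph G T)"
  by unfold_locales (auto simp: virt_graph_simps)

lemma symmetric_virt_graph: "symmetric (virt_graph G T)"
  by (auto simp: symmetric_conv virt_graph_simps virt_generates_commute)

lemma wf_digraph_proper_virt_graph: "wf_digraph (proper_virt_graph G T)"
  unfolding proper_virt_graph_def
  by (rule wf_digraph.wellformed_induce_subgraph[OF wf_digraph_virt_graph])


section \<open>The additive group of the $p$-adic integers\<close>

text \<open>The inverse limit of the groups $\mathbb{Z}/p^n$, where a $p$-adic integer is the sequence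
  of its least non-negative residues modulo the powers of $p$.\<close>

definition padic_int_group :: "nat \<Rightarrow> (nat \<Rightarrow> int) monoid" where
  "padic_int_group p =
     (let P = product_group UNIV (\<lambda>n. integer_mod_group (p ^ n))
      in P \<lparr> carrier := {a \<in> carrier P. \<forall>n. a (Suc n) mod int (p ^ n) = a n} \<rparr>)"

definition padic_int_topology :: "nat \<Rightarrow> (nat \<Rightarrow> int) topology" where
  "padic_int_topology p =
     subtopology
       (product_topology (\<lambda>n. discrete_topology (carrier (integer_mod_group (p ^ n)))) UNIV)
       (carrier (padic_int_group p))"


section \<open>The profinite wreath product\<close>

text \<open>The library topology on \<^typ>\<open>'a fps\<close> is the $X$-adic one, i.e. the product topology of the
  discrete topologies on the coefficients. The following is the action of $t^a$ for a $p$-adic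
  integer $a$: the limit of the action of $t^n$ for ordinary integers $n \to a$.\<close>

definition one_plus_X_pow :: "(nat \<Rightarrow> int) \<Rightarrow> 'p::prime_card mod_ring fps" where
  "one_plus_X_pow a = lim (\<lambda>n. (1 + fps_X) ^ nat (a n))"

text \<open>The pair $(f, a)$ stands for $f t^a$; here $p$ is the (prime) cardinality of the type argument.\<close>

definition wreath :: "'p::prime_card itself \<Rightarrow> ('p mod_ring fps \<times> (nat \<Rightarrow> int)) monoid" where
  "wreath _ =
     (let Zp = padic_int_group CARD('p) in
      \<lparr> carrier = UNIV \<times> carrier Zp,
        mult = (\<lambda>(f, a) (g, b). (f + one_plus_X_pow a * g, a \<otimes>\<^bsub>Zp\<^esub> b)),
        one = (0, \<one>\<^bsub>Zp\<^esub>) \<rparr>)"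

definition wreath_topology ::
    "'p::prime_card itself \<Rightarrow> ('p mod_ring fps \<times> (nat \<Rightarrow> int)) topology" where
  "wreath_topology _ = prod_topology euclidean (padic_int_topology CARD('p))"


section \<open>The profinite wreath product is a topological group\<close>

unbundle no vec_syntax
unbundle fps_syntax

lemma padic_simps:
  "\<one>\<^bsub>padic_int_group p\<^esub> = (\<lambda>_. 0)"
  "a \<otimes>\<^bsub>padic_int_group p\<^esub> b = (\<lambda>n. (a n + b n) mod int (p ^ n))"
  by (auto simp: padic_int_group_def Let_def)

lemma carrier_padic_int_group:
  assumes "p > 0"
  shows "carrier (padic_int_group p) =
    {a. \<forall>n. 0 \<le> a n \<and> a n < int (p ^ n) \<and> a (Suc n) mod int (p ^ n) = a n}"
  using assms by (auto simp: padic_int_group_def Let_def carrier_integer_mod_group PiE_iff)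

lemma padic_mod:
  assumes "p > 0" "a \<in> carrier (padic_int_group p)" "m \<le> n"
  shows "a n mod int (p ^ m) = a m"
  using \<open>m \<le> n\<close>
proof (induction n rule: dec_induct)
  case base
  show ?case using assms(1,2) by (simp add: carrier_padic_int_group)
next
  case (step n)
  have "int (p ^ m) dvd int (p ^ n)" using step.hyps by (simp add: le_imp_power_dvd)
  moreover have "a (Suc n) mod int (p ^ n) = a n"
    using assms(1,2) by (simp add: carrier_padic_int_group)
  ultimately show ?case using step.IH by (metis mod_mod_cancel)
qed

lemma group_padic_int_group:
  assumes "p > 0" shows "group (padic_int_group p)"
proof -
  have *: "(- x) mod (int p ^ n) mod int p ^ m = (- y) mod int p ^ m"
    if "x mod int p ^ m = y" "m \<le> n" for x y m n
    using that by (metis le_imp_power_dvd mod_minus_eq mod_mod_cancel)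
  have **: "(x + y) mod (int p * int p ^ n) mod int p ^ n = (x' + y') mod int p ^ n"
    if "x mod int p ^ n = x'" "y mod int p ^ n = y'" for x y x' y' n
    using that by (metis dvd_triv_right mod_add_eq mod_mod_cancel)
  show ?thesis
  proof (rule groupI)
    fix a b assume "a \<in> carrier (padic_int_group p)" "b \<in> carrier (padic_int_group p)"
    thus "a \<otimes>\<^bsub>padic_int_group p\<^esub> b \<in> carrier (padic_int_group p)"
      using assms by (auto simp: carrier_padic_int_group padic_simps intro!: **)
  next
    show "\<one>\<^bsub>padic_int_group p\<^esub> \<in> carrier (padic_int_group p)"
      using assms by (auto simp: carrier_padic_int_group padic_simps)
  next
    fix a b c :: "nat \<Rightarrow> int"
    show "a \<otimes>\<^bsub>padic_int_group p\<^esub> b \<otimes>\<^bsub>padic_int_group p\<^esub> c =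
          a \<otimes>\<^bsub>padic_int_group p\<^esub> (b \<otimes>\<^bsub>padic_int_group p\<^esub> c)"
      by (simp add: padic_simps mod_simps add.assoc)
  next
    fix a assume "a \<in> carrier (padic_int_group p)"
    thus "\<one>\<^bsub>padic_int_group p\<^esub> \<otimes>\<^bsub>padic_int_group p\<^esub> a = a"
      using assms by (auto simp: carrier_padic_int_group padic_simps)
  next
    fix a assume a: "a \<in> carrier (padic_int_group p)"
    show "\<exists>b\<in>carrier (padic_int_group p). b \<otimes>\<^bsub>padic_int_group p\<^esub> a = \<one>\<^bsub>padic_int_group p\<^esub>"
    proof (rule bexI[of _ "\<lambda>n. (- a n) mod int (p ^ n)"])
      show "(\<lambda>n. - a n mod int (p ^ n)) \<in> carrier (padic_int_group p)"
        using a assms *[of _ _ _ "Suc _"] by (auto simp: carrier_padic_int_group)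
    qed (simp add: padic_simps mod_simps)
  qed
qed

lemma inv_padic_int_group:
  assumes "p > 0" "a \<in> carrier (padic_int_group p)"
  shows "inv\<^bsub>padic_int_group p\<^esub> a = (\<lambda>n. (- a n) mod int (p ^ n))"
proof (rule group.inv_equality[OF group_padic_int_group[OF assms(1)]])
  have *: "(- x) mod (int p ^ n) mod int p ^ m = (- y) mod int p ^ m"
    if "x mod int p ^ m = y" "m \<le> n" for x y m n
    using that by (metis le_imp_power_dvd mod_minus_eq mod_mod_cancel)
  show "(\<lambda>n. - a n mod int (p ^ n)) \<in> carrier (padic_int_group p)"
    using assms *[of _ _ _ "Suc _"] by (auto simp: carrier_padic_int_group)
qed (use assms in \<open>simp_all add: padic_simps mod_simps\<close>)

lemma topspace_padic_int_topology:
  "topspace (padic_int_topology p) = carrier (padic_int_group p)"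
  by (auto simp: padic_int_topology_def padic_int_group_def Let_def)

lemma one_plus_X_power_cong:
  assumes "[M = N] (mod CARD('p) ^ m)" "k < CARD('p) ^ m"
  shows "((1 + fps_X) ^ M :: 'p::prime_card mod_ring fps) $ k = ((1 + fps_X) ^ N) $ k"
proof -
  let ?q = "CARD('p) ^ m" and ?Y = "1 + fps_X :: 'p mod_ring fps"
  have ch: "CHAR('p mod_ring fps) = CARD('p)" by simp
  have Yq: "?Y ^ ?q = 1 + fps_X ^ ?q"
    using freshmans_dream'[of ?q m "1 :: 'p mod_ring fps" fps_X] prime_card[where 'a='p]
    by (simp add: ch)
  have *: "(?Y ^ (L + ?q * j)) $ k = (?Y ^ L) $ k" for L j
  proof -
    have "fps_X ^ ?q dvd (1 + fps_X ^ ?q) ^ j - (1 ^ j :: 'p mod_ring fps)"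
      unfolding power_diff_sumr2 by simp
    then obtain h where h: "(1 + fps_X ^ ?q) ^ j = 1 + fps_X ^ ?q * (h :: 'p mod_ring fps)"
      by (auto simp: algebra_simps elim!: dvdE)
    have "?Y ^ (L + ?q * j) = ?Y ^ L + fps_X ^ ?q * (?Y ^ L * h)"
      by (simp only: power_add power_mult Yq h) (simp add: algebra_simps)
    thus ?thesis using assms(2) by (simp add: fps_X_power_mult_nth)
  qed
  have "(?Y ^ M) $ k = (?Y ^ (M mod ?q)) $ k" "(?Y ^ N) $ k = (?Y ^ (N mod ?q)) $ k"
    using *[of "M mod ?q" "M div ?q"] *[of "N mod ?q" "N div ?q"] by simp_all
  thus ?thesis using assms(1) by (simp add: cong_def)
qed

lemma card_pos: "CARD('p::prime_card) > 0"
  using prime_card[where 'a='p] by (simp add: prime_gt_0_nat)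

lemma less_card_power: "k < CARD('p::prime_card) ^ k"
  using prime_card[where 'a='p] prime_gt_1_nat by (simp add: power_gt_expt)

lemma one_plus_X_power_padic:
  assumes "a \<in> carrier (padic_int_group CARD('p))" "k \<le> m"
  shows "((1 + fps_X) ^ nat (a m) :: 'p::prime_card mod_ring fps) $ k = ((1 + fps_X) ^ nat (a k)) $ k"
proof (rule one_plus_X_power_cong)
  have "a m mod int (CARD('p) ^ k) = a k mod int (CARD('p) ^ k)"
    using padic_mod[OF card_pos assms] padic_mod[OF card_pos assms(1), of k k] by simp
  moreover have "a m \<ge> 0" "a k \<ge> 0"
    using assms(1) by (simp_all add: carrier_padic_int_group[OF card_pos])
  ultimately show "[nat (a m) = nat (a k)] (mod CARD('p) ^ k)"
    by (metis cong_def cong_int_iff nat_0_le)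
qed (rule less_card_power)

lemma tendsto_one_plus_X_pow:
  assumes "a \<in> carrier (padic_int_group CARD('p))"
  shows "(\<lambda>n. (1 + fps_X) ^ nat (a n)) \<longlonglongrightarrow> (one_plus_X_pow a :: 'p::prime_card mod_ring fps)"
proof -
  let ?l = "Abs_fps (\<lambda>k. ((1 + fps_X :: 'p mod_ring fps) ^ nat (a k)) $ k)"
  have "(\<lambda>n. (1 + fps_X) ^ nat (a n)) \<longlonglongrightarrow> ?l"
  proof (rule tendsto_fpsI, rule eventually_sequentiallyI)
    fix k n :: nat assume "k \<le> n"
    from one_plus_X_power_padic[where 'p='p, OF assms this]
    show "((1 + fps_X) ^ nat (a n)) $ k = ?l $ k" by (simp only: fps_nth_Abs_fps)
  qed
  thus ?thesis unfolding one_plus_X_pow_def by (simp only: limI)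
qed

lemma one_plus_X_pow_nth:
  assumes "a \<in> carrier (padic_int_group CARD('p))" "k \<le> m"
  shows "(one_plus_X_pow a :: 'p::prime_card mod_ring fps) $ k = ((1 + fps_X) ^ nat (a m)) $ k"
proof -
  have "\<forall>\<^sub>F n in sequentially. ((1 + fps_X) ^ nat (a n)) $ k = (one_plus_X_pow a :: 'p mod_ring fps) $ k"
    using tendsto_one_plus_X_pow[OF assms(1)] by (simp add: tendsto_fps_iff)
  then obtain N where N: "\<And>n. n \<ge> N \<Longrightarrow> ((1 + fps_X) ^ nat (a n)) $ k = (one_plus_X_pow a :: 'p mod_ring fps) $ k"
    by (auto simp: eventually_sequentially)
  have "(one_plus_X_pow a :: 'p mod_ring fps) $ k = ((1 + fps_X) ^ nat (a (max N k))) $ k"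
    by (rule N[symmetric]) simp
  also have "\<dots> = ((1 + fps_X) ^ nat (a k)) $ k"
    by (rule one_plus_X_power_padic[OF assms(1)]) simp
  also have "\<dots> = ((1 + fps_X) ^ nat (a m)) $ k"
    by (rule one_plus_X_power_padic[OF assms, symmetric])
  finally show ?thesis .
qed

lemma one_plus_X_pow_add:
  assumes a: "a \<in> carrier (padic_int_group CARD('p))" and b: "b \<in> carrier (padic_int_group CARD('p))"
  shows "one_plus_X_pow (a \<otimes>\<^bsub>padic_int_group CARD('p)\<^esub> b) =
           (one_plus_X_pow a * one_plus_X_pow b :: 'p::prime_card mod_ring fps)"
proof (rule fps_ext)
  fix k
  let ?Y = "1 + fps_X :: 'p mod_ring fps"
  interpret Zp: group "padic_int_group CARD('p)" by (rule group_padic_int_group[OF card_pos])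
  have nn: "a k \<ge> 0" "b k \<ge> 0"
    using a b by (simp_all add: carrier_padic_int_group[OF card_pos])
  have "(one_plus_X_pow a * one_plus_X_pow b :: 'p mod_ring fps) $ k = (?Y ^ nat (a k) * ?Y ^ nat (b k)) $ k"
    unfolding fps_mult_nth
    by (rule sum.cong) (auto simp: one_plus_X_pow_nth[OF a, of _ k] one_plus_X_pow_nth[OF b, of _ k])
  also have "\<dots> = (?Y ^ (nat (a k + b k))) $ k"
    using nn by (simp add: nat_add_distrib power_add)
  also have "\<dots> = (?Y ^ nat ((a k + b k) mod int (CARD('p) ^ k))) $ k"
  proof (rule one_plus_X_power_cong)
    show "[nat (a k + b k) = nat ((a k + b k) mod int (CARD('p) ^ k))] (mod CARD('p) ^ k)"
      using nn by (metis add_nonneg_nonneg cong_mod_right cong_refl nat_int nat_mod_distrib of_nat_0_le_iff)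
  qed (rule less_card_power)
  also have "\<dots> = (one_plus_X_pow (a \<otimes>\<^bsub>padic_int_group CARD('p)\<^esub> b) :: 'p mod_ring fps) $ k"
    using one_plus_X_pow_nth[where m=k and 'p='p, OF Zp.m_closed[OF a b]] by (simp add: padic_simps)
  finally show "(one_plus_X_pow (a \<otimes>\<^bsub>padic_int_group CARD('p)\<^esub> b) :: 'p mod_ring fps) $ k =
    (one_plus_X_pow a * one_plus_X_pow b) $ k" ..
qed

lemma one_plus_X_pow_0: "one_plus_X_pow (\<lambda>_. 0) = 1"
  unfolding one_plus_X_pow_def by (simp add: limI)

lemma wreath_simps:
  "carrier (wreath TYPE('p::prime_card)) = UNIV \<times> carrier (padic_int_group CARD('p))"
  "\<one>\<^bsub>wreath TYPE('p)\<^esub> = (0, \<lambda>_. 0)"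
  "(f, a) \<otimes>\<^bsub>wreath TYPE('p)\<^esub> (g, b) = (f + one_plus_X_pow a * g, a \<otimes>\<^bsub>padic_int_group CARD('p)\<^esub> b)"
  by (simp_all add: wreath_def Let_def padic_simps)


lemma group_wreath: "group (wreath TYPE('p::prime_card))"
proof -
  interpret Zp: group "padic_int_group CARD('p)" by (rule group_padic_int_group[OF card_pos])
  have one: "(\<lambda>_. 0) \<in> carrier (padic_int_group CARD('p))"
    using Zp.one_closed by (simp add: padic_simps)
  have l_one: "(\<lambda>_. 0) \<otimes>\<^bsub>padic_int_group CARD('p)\<^esub> a = a" if "a \<in> carrier (padic_int_group CARD('p))" for a
    using Zp.l_one[OF that] by (simp only: padic_simps(1))
  have l_inv: "inv\<^bsub>padic_int_group CARD('p)\<^esub> a \<otimes>\<^bsub>padic_int_group CARD('p)\<^esub> a = (\<lambda>_. 0)"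
    if "a \<in> carrier (padic_int_group CARD('p))" for a
    using Zp.l_inv[OF that] by (simp only: padic_simps(1))
  show ?thesis
  proof (rule groupI)
    fix x assume x: "x \<in> carrier (wreath TYPE('p))"
    obtain f a where [simp]: "x = (f, a)" by fastforce
    show "\<exists>y\<in>carrier (wreath TYPE('p)). y \<otimes>\<^bsub>wreath TYPE('p)\<^esub> x = \<one>\<^bsub>wreath TYPE('p)\<^esub>"
      using x by (intro bexI[of _ "(- one_plus_X_pow (inv\<^bsub>padic_int_group CARD('p)\<^esub> a) * f, inv\<^bsub>padic_int_group CARD('p)\<^esub> a)"])
        (auto simp: wreath_simps padic_simps(1))
  qed (auto simp: wreath_simps one l_one one_plus_X_pow_0 one_plus_X_pow_add algebra_simps Zp.m_assoc)
qed

lemma inv_wreath: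
  assumes "a \<in> carrier (padic_int_group CARD('p))"
  shows "inv\<^bsub>wreath TYPE('p::prime_card)\<^esub> (f, a) =
    (- one_plus_X_pow (inv\<^bsub>padic_int_group CARD('p)\<^esub> a) * f, inv\<^bsub>padic_int_group CARD('p)\<^esub> a)"
proof -
  interpret Zp: group "padic_int_group CARD('p)" by (rule group_padic_int_group[OF card_pos])
  show ?thesis
  proof (rule group.inv_equality[OF group_wreath])
    let ?b = "inv\<^bsub>padic_int_group CARD('p)\<^esub> a"
    have "?b \<otimes>\<^bsub>padic_int_group CARD('p)\<^esub> a = (\<lambda>_. 0)"
      using Zp.l_inv[OF assms] by (simp only: padic_simps(1))
    thus "(- one_plus_X_pow ?b * f, ?b) \<otimes>\<^bsub>wreath TYPE('p)\<^esub> (f, a) = \<one>\<^bsub>wreath TYPE('p)\<^esub>"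
      by (simp add: wreath_simps)
  qed (use assms Zp.inv_closed[OF assms] in \<open>simp_all add: wreath_simps\<close>)
qed

text \<open>Local constancy: for the discrete topology, the $X$-adic topology and the topology of the
  $p$-adic integers, continuity is local constancy of every coordinate.\<close>

definition loc_const :: "'a topology \<Rightarrow> ('a \<Rightarrow> 'b) \<Rightarrow> bool" where
  "loc_const X g \<longleftrightarrow> (\<forall>x \<in> topspace X. eventually (\<lambda>y. g y = g x) (atin X x))"

lemma loc_constI: "(\<And>x. x \<in> topspace X \<Longrightarrow> eventually (\<lambda>y. g y = g x) (atin X x)) \<Longrightarrow> loc_const X g"
  by (simp add: loc_const_def)

lemma loc_constD: "loc_const X g \<Longrightarrow> x \<in> topspace X \<Longrightarrow> eventually (\<lambda>y. g y = g x) (atin X x)"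
  by (simp add: loc_const_def)

lemma loc_const_map:
  assumes "loc_const X g" shows "loc_const X (\<lambda>x. h (g x))"
proof (rule loc_constI)
  fix x assume "x \<in> topspace X"
  from loc_constD[OF assms this] show "eventually (\<lambda>y. h (g y) = h (g x)) (atin X x)"
    by eventually_elim simp
qed

lemma loc_const_map2:
  assumes "loc_const X g" "loc_const X g'" shows "loc_const X (\<lambda>x. h (g x) (g' x))"
proof (rule loc_constI)
  fix x assume x: "x \<in> topspace X"
  from loc_constD[OF assms(1) x] loc_constD[OF assms(2) x]
  show "eventually (\<lambda>y. h (g y) (g' y) = h (g x) (g' x)) (atin X x)"
    by eventually_elim simp
qed

lemma loc_const_cong:
  assumes "loc_const X g" "\<And>x. x \<in> topspace X \<Longrightarrow> g x = h x" shows "loc_const X h"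
proof (rule loc_constI)
  fix x assume x: "x \<in> topspace X"
  have "eventually (\<lambda>y. y \<in> topspace X) (atin X x)"
    unfolding eventually_atin using openin_topspace x by blast
  with loc_constD[OF assms(1) x] show "eventually (\<lambda>y. h y = h x) (atin X x)"
    by eventually_elim (use assms(2) x in simp)
qed

lemma loc_const_sum:
  assumes "finite A" "\<And>i. i \<in> A \<Longrightarrow> loc_const X (g i)"
  shows "loc_const X (\<lambda>x. \<Sum>i\<in>A. g i x)"
  using assms
proof (induction A rule: finite_induct)
  case empty
  show ?case by (simp add: loc_const_def)
next
  case (insert i A)
  have "loc_const X (\<lambda>x. g i x + (\<Sum>i\<in>A. g i x))"
    by (rule loc_const_map2[where h = "(+)"]) (use insert in simp_all)
  thus ?case using insert.hyps by simp
qed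

lemma continuous_map_fps_iff:
  "continuous_map X euclidean (g :: 'a \<Rightarrow> 'b::group_add fps) \<longleftrightarrow> (\<forall>k. loc_const X (\<lambda>x. g x $ k))"
  by (auto simp: continuous_map_atin tendsto_fps_iff loc_const_def)

lemma continuous_map_discrete_iff:
  "continuous_map X (discrete_topology C) g \<longleftrightarrow> g \<in> topspace X \<rightarrow> C \<and> loc_const X g"
proof -
  have "limitin (discrete_topology C) g l F \<longleftrightarrow> l \<in> C \<and> eventually (\<lambda>y. g y = l) F" for l and F :: "'a filter"
  proof (cases "l \<in> C")
    case True
    have "(\<forall>U. openin (discrete_topology C) U \<and> l \<in> U \<longrightarrow> eventually (\<lambda>x. g x \<in> U) F) \<longleftrightarrow>
        eventually (\<lambda>y. g y = l) F"
    proof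
      assume "\<forall>U. openin (discrete_topology C) U \<and> l \<in> U \<longrightarrow> eventually (\<lambda>x. g x \<in> U) F"
      from spec[OF this, of "{l}"] show "eventually (\<lambda>y. g y = l) F" using True by simp
    next
      assume *: "eventually (\<lambda>y. g y = l) F"
      have "eventually (\<lambda>x. g x \<in> U) F" if "l \<in> U" for U
        using * by eventually_elim (use that in simp)
      thus "\<forall>U. openin (discrete_topology C) U \<and> l \<in> U \<longrightarrow> eventually (\<lambda>x. g x \<in> U) F" by blast
    qed
    thus ?thesis using True by (simp add: limitin_def)
  qed (simp add: limitin_def)
  thus ?thesis by (auto simp: continuous_map_atin loc_const_def)
qed

lemma continuous_map_padic_iff:
  "continuous_map X (padic_int_topology p) g \<longleftrightarrow>
     g \<in> topspace X \<rightarrow> carrier (padic_int_group p) \<and> (\<forall>n. loc_const X (\<lambda>x. g x n))"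
proof -
  have "a n \<in> carrier (integer_mod_group (p ^ n))" if "a \<in> carrier (padic_int_group p)" for a n
    using that by (auto simp: padic_int_group_def Let_def PiE_iff)
  thus ?thesis
    unfolding padic_int_topology_def continuous_map_in_subtopology continuous_map_componentwise_UNIV
      continuous_map_discrete_iff Pi_iff image_subset_iff by blast
qed

lemma loc_const_fps_mult:
  fixes f g :: "'a \<Rightarrow> 'b::comm_ring_1 fps"
  assumes "\<And>k. loc_const X (\<lambda>x. f x $ k)" "\<And>k. loc_const X (\<lambda>x. g x $ k)"
  shows "loc_const X (\<lambda>x. (f x * g x) $ k)"
  unfolding fps_mult_nth
proof (rule loc_const_sum)
  show "loc_const X (\<lambda>x. f x $ i * g x $ (k - i))" for i
    by (rule loc_const_map2[where h = "(*)", OF assms])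
qed simp

lemma loc_const_one_plus_X_pow:
  assumes "\<And>x. x \<in> topspace X \<Longrightarrow> a x \<in> carrier (padic_int_group CARD('p))"
    "\<And>n. loc_const X (\<lambda>x. a x n)"
  shows "loc_const X (\<lambda>x. (one_plus_X_pow (a x) :: 'p::prime_card mod_ring fps) $ k)"
proof (rule loc_const_cong)
  show "loc_const X (\<lambda>x. ((1 + fps_X :: 'p mod_ring fps) ^ nat (a x k)) $ k)"
    by (rule loc_const_map[OF assms(2)])
  show "((1 + fps_X :: 'p mod_ring fps) ^ nat (a x k)) $ k = one_plus_X_pow (a x) $ k"
    if "x \<in> topspace X" for x
    by (rule one_plus_X_pow_nth[symmetric, OF assms(1)[OF that] order_refl])
qed

lemma topological_group_wreath:
  "topological_group (wreath TYPE('p::prime_card)) (wreath_topology TYPE('p))"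
proof -
  interpret Zp: group "padic_int_group CARD('p)" by (rule group_padic_int_group[OF card_pos])
  interpret W: group "wreath TYPE('p)" by (rule group_wreath)
  let ?T = "wreath_topology TYPE('p)"
  have top: "topspace ?T = UNIV \<times> carrier (padic_int_group CARD('p))"
    by (simp add: wreath_topology_def topspace_padic_int_topology)
  have into: "continuous_map X ?T g \<longleftrightarrow>
      (\<forall>k. loc_const X (\<lambda>x. fst (g x) $ k)) \<and>
      (\<forall>x \<in> topspace X. snd (g x) \<in> carrier (padic_int_group CARD('p))) \<and>
      (\<forall>n. loc_const X (\<lambda>x. snd (g x) n))" for X :: "'c topology" and g
    by (auto simp: wreath_topology_def continuous_map_pairwise o_def continuous_map_fps_iff
        continuous_map_padic_iff Pi_iff)
  show ?thesis
  proof unfold_locales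
    show "topspace ?T = carrier (wreath TYPE('p))" by (simp add: top wreath_simps)
  next
    let ?X = "prod_topology ?T ?T"
    have "continuous_map ?X ?T fst" "continuous_map ?X ?T snd"
      by (simp_all add: continuous_map_fst continuous_map_snd)
    note * = this[unfolded into]
    have fst: "loc_const ?X (\<lambda>z. fst (fst z) $ k)" "loc_const ?X (\<lambda>z. fst (snd z) $ k)" for k
      using * by simp_all
    have snd: "loc_const ?X (\<lambda>z. snd (fst z) n)" "loc_const ?X (\<lambda>z. snd (snd z) n)" for n
      using * by simp_all
    have "loc_const ?X (\<lambda>z. (fst (fst z) + one_plus_X_pow (snd (fst z)) * fst (snd z)) $ k)" for k
    proof -
      have "loc_const ?X (\<lambda>z. (one_plus_X_pow (snd (fst z)) * fst (snd z)) $ k)"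
      proof (rule loc_const_fps_mult[where f = "\<lambda>z. one_plus_X_pow (snd (fst z))" and g = "\<lambda>z. fst (snd z)"])
        show "loc_const ?X (\<lambda>z. (one_plus_X_pow (snd (fst z)) :: 'p mod_ring fps) $ k)" for k
          by (rule loc_const_one_plus_X_pow[where a = "\<lambda>z. snd (fst z)", OF _ snd(1)]) (auto simp: top)
      qed (rule fst(2))
      from loc_const_map2[OF fst(1)[of k] this, of "(+)"] show ?thesis
        by (simp only: fps_add_nth)
    qed
    moreover have "loc_const ?X (\<lambda>z. (snd (fst z) \<otimes>\<^bsub>padic_int_group CARD('p)\<^esub> snd (snd z)) n)" for n
      using loc_const_map2[OF snd, of "\<lambda>x y. (x + y) mod int (CARD('p) ^ n)" n n] by (simp add: padic_simps)
    ultimately have "continuous_map ?X ?T (\<lambda>z. (fst (fst z) + one_plus_X_pow (snd (fst z)) * fst (snd z),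
        snd (fst z) \<otimes>\<^bsub>padic_int_group CARD('p)\<^esub> snd (snd z)))"
      unfolding into by (auto simp: top simp del: fps_add_nth)
    thus "continuous_map ?X ?T (\<lambda>(x, y). x \<otimes>\<^bsub>wreath TYPE('p)\<^esub> y)"
      by (rule continuous_map_eq) (auto simp: wreath_simps)
  next
    have "continuous_map ?T ?T (\<lambda>x. x)" by simp
    note * = this[unfolded into]
    have **: "continuous_map ?T ?T (\<lambda>(f, a). (- one_plus_X_pow (inv\<^bsub>padic_int_group CARD('p)\<^esub> a) * f, inv\<^bsub>padic_int_group CARD('p)\<^esub> a))"
    proof -
      have i: "loc_const ?T (\<lambda>x. (inv\<^bsub>padic_int_group CARD('p)\<^esub> (snd x)) n)" for n
        by (rule loc_const_cong[OF loc_const_map[of ?T "\<lambda>x. snd x n" "\<lambda>y. (- y) mod int (CARD('p) ^ n)"]])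
           (use * in \<open>auto simp: top inv_padic_int_group[OF card_pos]\<close>)
      have "loc_const ?T (\<lambda>x. (one_plus_X_pow (inv\<^bsub>padic_int_group CARD('p)\<^esub> (snd x)) :: 'p mod_ring fps) $ k)" for k
        by (rule loc_const_one_plus_X_pow[where a = "\<lambda>x. inv\<^bsub>padic_int_group CARD('p)\<^esub> (snd x)", OF _ i]) (auto simp: top)
      from loc_const_map[OF this, of uminus]
      have "loc_const ?T (\<lambda>x. (- one_plus_X_pow (inv\<^bsub>padic_int_group CARD('p)\<^esub> (snd x)) :: 'p mod_ring fps) $ k)" for k
        by simp
      moreover have "loc_const ?T (\<lambda>x. fst x $ k)" for k
        using * by simp
      ultimately have "loc_const ?T (\<lambda>x. (- one_plus_X_pow (inv\<^bsub>padic_int_group CARD('p)\<^esub> (snd x)) * fst x) $ k)" for k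
        by (rule loc_const_fps_mult[where f = "\<lambda>x. - one_plus_X_pow (inv\<^bsub>padic_int_group CARD('p)\<^esub> (snd x))" and g = fst])
      with i show ?thesis
        unfolding into case_prod_unfold by (auto simp: top)
    qed
    show "continuous_map ?T ?T (\<lambda>x. inv\<^bsub>wreath TYPE('p)\<^esub> x)"
      by (rule continuous_map_eq[OF **]) (auto simp: top inv_wreath)
  qed
qed

unbundle no fps_syntax
unbundle vec_syntax

end

theory Submission
  imports Defs
begin

unbundle no vec_syntax
unbundle fps_syntax

text \<open>A pair of commuting elements never generates an open subgroup: the two elements would centralize
  its closure, whereas the only element centralizing a neighbourhood of the identity is the
  identity itself. Conversely, a pair consisting of $x$ and $y = (g, 1)$ that does not commute
  generates an open subgroup. Any two nontrivial elements admit a common $y$ of this form that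
  commutes with neither, so all distances are at most 2, and the commuting elements $(1, 0)$ and
  $(X, 0)$ are at distance exactly 2.\<close>

section \<open>Closed subgroups of topological groups\<close>

context topological_group
begin

lemma continuous_left_mult:
  assumes "a \<in> carrier G"
  shows "continuous_map T T (\<lambda>x. a \<otimes> x)"
proof -
  have "continuous_map T (prod_topology T T) (\<lambda>x. (a, x))"
    using assms by (simp add: continuous_map_pairwise o_def topspace_eq)
  from continuous_map_compose[OF this continuous_mult] show ?thesis by (simp add: o_def)
qed

lemma continuous_inv_mult:
  assumes "b \<in> carrier G"
  shows "continuous_map T T (\<lambda>x. inv x \<otimes> b)"
proof -
  have "continuous_map T (prod_topology T T) (\<lambda>x. (inv x, b))"
    using assms continuous_inv by (simp add: continuous_map_pairwise o_def topspace_eq)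
  from continuous_map_compose[OF this continuous_mult] show ?thesis by (simp add: o_def)
qed

text \<open>The closure is the union of the translates kU with k in K: for z in the closure, the set
  of w with w^-1 z in U is a neighbourhood of z because U contains the identity, so it meets K.
  Openness thus only has to be checked at the identity.\<close>

lemma openin_closure_of_subgroup:
  assumes K: "subgroup K G" and U: "openin T U" "\<one> \<in> U" "U \<subseteq> T closure_of K"
  shows "openin T (T closure_of K)"
proof -
  interpret K: subgroup K G by fact
  let ?V = "\<Union>k\<in>K. {w \<in> carrier G. inv k \<otimes> w \<in> U}"
  have "openin T {w \<in> topspace T. inv k \<otimes> w \<in> U}" if "k \<in> K" for k
    by (rule openin_continuous_map_preimage[OF continuous_left_mult U(1)]) (use that in simp)
  hence "openin T ?V"
    unfolding topspace_eq by (intro openin_Union) auto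
  moreover have "T closure_of K = ?V"
  proof (intro equalityI subsetI)
    fix z assume z: "z \<in> T closure_of K"
    hence zG: "z \<in> carrier G"
      using closure_of_subset_topspace[of T K] by (auto simp: topspace_eq)
    have "openin T {w \<in> topspace T. inv w \<otimes> z \<in> U}"
      by (rule openin_continuous_map_preimage[OF continuous_inv_mult[OF zG] U(1)])
    moreover have "z \<in> {w \<in> topspace T. inv w \<otimes> z \<in> U}"
      using zG U(2) by (simp add: topspace_eq)
    ultimately have "\<exists>k. k \<in> K \<and> k \<in> {w \<in> topspace T. inv w \<otimes> z \<in> U}"
      using z unfolding in_closure_of by (elim conjE allE impE) (rule conjI)
    then obtain k where "k \<in> K" "inv k \<otimes> z \<in> U" by auto
    thus "z \<in> ?V" using zG by blast
  next
    fix z assume "z \<in> ?V"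
    then obtain k where k: "k \<in> K" and z: "z \<in> carrier G" "inv k \<otimes> z \<in> U" by auto
    have "(\<lambda>x. k \<otimes> x) ` (T closure_of K) \<subseteq> T closure_of ((\<lambda>x. k \<otimes> x) ` K)"
      by (rule continuous_map_image_closure_subset[OF continuous_left_mult]) (use k in simp)
    also have "\<dots> \<subseteq> T closure_of K"
      by (rule closure_of_mono) (use k in auto)
    finally have "k \<otimes> (inv k \<otimes> z) \<in> T closure_of K" using z(2) U(3) by auto
    moreover have "k \<otimes> (inv k \<otimes> z) = z"
      using k z(1) by (simp flip: m_assoc)
    ultimately show "z \<in> T closure_of K" by simp
  qed
  ultimately show ?thesis by simp
qed

end

section \<open>Centralizers and locally constant maps\<close>

lemma (in group) commute_generate:
  assumes "x \<in> carrier G" "S \<subseteq> carrier G" "\<And>y. y \<in> S \<Longrightarrow> x \<otimes> y = y \<otimes> x"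
    and "z \<in> generate G S"
  shows "x \<otimes> z = z \<otimes> x"
proof -
  have "subgroup {z \<in> carrier G. x \<otimes> z = z \<otimes> x} G"
  proof (rule subgroupI)
    fix a assume "a \<in> {z \<in> carrier G. x \<otimes> z = z \<otimes> x}"
    hence a: "a \<in> carrier G" "x \<otimes> a = a \<otimes> x" by auto
    have "x \<otimes> inv a = inv a \<otimes> (a \<otimes> x) \<otimes> inv a"
      using a(1) assms(1) by (metis inv_closed l_inv l_one m_assoc)
    also have "\<dots> = inv a \<otimes> (x \<otimes> a) \<otimes> inv a" by (simp only: a(2))
    also have "\<dots> = inv a \<otimes> x" using a(1) assms(1) by (simp add: m_assoc)
    finally show "inv a \<in> {z \<in> carrier G. x \<otimes> z = z \<otimes> x}" using a(1) by simp
  next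
    fix a b assume "a \<in> {z \<in> carrier G. x \<otimes> z = z \<otimes> x}" "b \<in> {z \<in> carrier G. x \<otimes> z = z \<otimes> x}"
    thus "a \<otimes> b \<in> {z \<in> carrier G. x \<otimes> z = z \<otimes> x}"
      using assms(1) by (auto simp: m_assoc) (metis m_assoc)
  qed (use assms(1) in auto)
  from generate_subgroup_incl[OF _ this, of S] show ?thesis using assms by blast
qed

text \<open>A neighbourhood of z on which g is constant meets S. This carries commutation relations
  from a subgroup over to its closure.\<close>

lemma loc_const_closure_of:
  assumes "loc_const X g" "\<And>y. y \<in> S \<Longrightarrow> g y = c" "z \<in> X closure_of S"
  shows "g z = c"
proof -
  have "z \<in> topspace X" using assms(3) by (simp add: in_closure_of)
  with loc_constD[OF assms(1) this] obtain U where
    "openin X U" "z \<in> U" and U: "\<And>y. y \<in> U - {z} \<Longrightarrow> g y = g z"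
    by (auto simp: eventually_atin)
  then obtain y where "y \<in> S" "y \<in> U" using assms(3) by (meson in_closure_of)
  with U[of y] assms(2)[of y] show ?thesis by (cases "y = z") auto
qed

lemma openin_loc_const:
  assumes "loc_const X g" shows "openin X {x \<in> topspace X. g x = c}"
proof (subst openin_subopen, intro ballI)
  fix x assume x: "x \<in> {x \<in> topspace X. g x = c}"
  hence "x \<in> topspace X" by simp
  with loc_constD[OF assms this] obtain U where
    U: "openin X U" "x \<in> U" "\<And>y. y \<in> U - {x} \<Longrightarrow> g y = g x"
    unfolding eventually_atin by blast
  moreover have "U \<subseteq> {x \<in> topspace X. g x = c}"
    using U x openin_subset[OF U(1)] by blast
  ultimately show "\<exists>U. openin X U \<and> x \<in> U \<and> U \<subseteq> {x \<in> topspace X. g x = c}" by blast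
qed


section \<open>Natural powers of the generator of the top group\<close>

text \<open>The canonical map from the naturals to the p-adic integers;
  \<open>(0, padic_of_nat p n)\<close> stands for t^n.\<close>

definition padic_of_nat :: "nat \<Rightarrow> nat \<Rightarrow> nat \<Rightarrow> int" where
  "padic_of_nat p n = (\<lambda>k. int n mod int (p ^ k))"

lemma padic_of_nat_carrier: "p > 0 \<Longrightarrow> padic_of_nat p n \<in> carrier (padic_int_group p)"
  by (simp add: carrier_padic_int_group padic_of_nat_def mod_mod_cancel)

lemma padic_of_nat_add:
  "padic_of_nat p m \<otimes>\<^bsub>padic_int_group p\<^esub> padic_of_nat p n = padic_of_nat p (m + n)"
  by (simp add: padic_simps padic_of_nat_def mod_simps)

text \<open>Coefficient k of a power of 1 + X depends only on the exponent modulo p^k, because k <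
  p^k.\<close>

lemma one_plus_X_pow_of_nat:
  "one_plus_X_pow (padic_of_nat CARD('p) n) = ((1 + fps_X) ^ n :: 'p::prime_card mod_ring fps)"
proof (rule fps_ext)
  fix k
  have "(one_plus_X_pow (padic_of_nat CARD('p) n) :: 'p mod_ring fps) $ k =
      ((1 + fps_X) ^ nat (padic_of_nat CARD('p) n k)) $ k"
    by (rule one_plus_X_pow_nth[OF padic_of_nat_carrier[OF card_pos] order_refl])
  also have "\<dots> = ((1 + fps_X) ^ n) $ k"
  proof (rule one_plus_X_power_cong[where m = k])
    show "[nat (padic_of_nat CARD('p) n k) = n] (mod CARD('p) ^ k)"
      unfolding padic_of_nat_def by (simp add: cong_def nat_mod_distrib flip: of_nat_power zmod_int)
  qed (rule less_card_power)
  finally show "(one_plus_X_pow (padic_of_nat CARD('p) n) :: 'p mod_ring fps) $ k = ((1 + fps_X) ^ n) $ k" .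
qed

text \<open>Used with z = X^(p^n): the remainder then starts in degree 2 p^n, so coefficient p^n
  comes from the linear term alone.\<close>

lemma one_plus_power_expand: "\<exists>r. (1 + z :: 'a::comm_ring_1) ^ n = 1 + of_nat n * z + z ^ 2 * r"
proof (induction n)
  case (Suc n)
  then obtain r where "(1 + z) ^ n = 1 + of_nat n * z + z ^ 2 * r" by blast
  hence "(1 + z) ^ Suc n = 1 + of_nat (Suc n) * z + z ^ 2 * (of_nat n + r + z * r)"
    by (simp add: algebra_simps power2_eq_square)
  thus ?case by blast
qed (auto intro: exI[of _ 0])

text \<open>If $a$ has valuation $n$, then $(1+X)^a = (1+X^{p^n})^u$ for a $p$-adic unit $u$, so the
  coefficient of $X^{p^n}$ does not vanish.\<close>

lemma one_plus_X_pow_eq_1D: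
  assumes a: "a \<in> carrier (padic_int_group CARD('p))"
    and eq: "(one_plus_X_pow a :: 'p::prime_card mod_ring fps) = 1"
  shows "a = (\<lambda>_. 0)"
proof (rule ccontr)
  let ?p = "CARD('p)"
  assume "a \<noteq> (\<lambda>_. 0)"
  hence ex: "\<exists>n. a n \<noteq> 0" by auto
  \<comment> \<open>The first level with a nonzero residue. It is positive because residues modulo
    p^0 vanish, and the valuation of a is n = l - 1.\<close>
  define l where "l = (LEAST n. a n \<noteq> 0)"
  have l: "a l \<noteq> 0" "\<And>n. n < l \<Longrightarrow> a n = 0"
    unfolding l_def using LeastI_ex[OF ex] not_less_Least by blast+
  have bnd: "0 \<le> a n" "a n < int (?p ^ n)" for n
    using a by (auto simp: carrier_padic_int_group[OF card_pos])
  have "l \<noteq> 0" using l(1) bnd[of 0] by (intro notI) simp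
  then obtain n where n: "l = Suc n" by (cases l) auto
  let ?q = "?p ^ n"
  have q: "n < ?q" by (rule less_card_power)
  \<comment> \<open>Level \<open>?q\<close> is fine enough for both uses of N: it determines
    coefficient \<open>?q\<close> of the power, and it is at least \<open>l\<close> since n < p^n,
    so N is divisible by p^n but not by p^(n+1).\<close>
  define N where "N = nat (a ?q)"
  have N: "int N = a ?q" by (simp add: N_def bnd)
  have "a ?q mod int ?q = 0"
    using padic_mod[OF card_pos a, of n ?q] q l(2)[of n] n by simp
  hence "int ?q dvd int N" by (simp add: N dvd_eq_mod_eq_0)
  then obtain u where u: "N = ?q * u" by (auto elim!: dvdE simp only: of_nat_dvd_iff)
  have "a ?q mod int (?p ^ l) \<noteq> 0"
    using padic_mod[OF card_pos a, of l ?q] q l(1) n by simp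
  hence "\<not> ?p ^ Suc n dvd N"
    unfolding N[symmetric] n by (metis dvd_imp_mod_0 of_nat_dvd_iff)
  hence "\<not> ?p dvd u" unfolding u by auto
  hence unz: "(of_nat u :: 'p mod_ring) \<noteq> 0"
    by (simp add: of_nat_eq_0_iff_char_dvd)
  have Yq: "(1 + fps_X :: 'p mod_ring fps) ^ ?q = 1 + fps_X ^ ?q"
    using freshmans_dream'[of ?q n "1 :: 'p mod_ring fps" fps_X] prime_card[where 'a='p] by simp
  obtain r where r: "(1 + fps_X ^ ?q :: 'p mod_ring fps) ^ u =
      1 + of_nat u * fps_X ^ ?q + (fps_X ^ ?q)\<^sup>2 * r"
    using one_plus_power_expand by blast
  have "(one_plus_X_pow a :: 'p mod_ring fps) $ ?q = ((1 + fps_X) ^ N) $ ?q"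
    unfolding N_def by (rule one_plus_X_pow_nth[OF a order_refl])
  also have "\<dots> = (1 + of_nat u * fps_X ^ ?q + fps_X ^ ?q * (fps_X ^ ?q * r)) $ ?q"
    unfolding u power_mult Yq r by (simp only: power2_eq_square mult.assoc)
  also have "\<dots> = of_nat u"
    using q by (simp add: fps_X_power_mult_nth fps_of_nat[symmetric] del: fps_of_nat)
  finally show False using eq unz q by simp
qed


section \<open>Approximation in the wreath product\<close>

lemma topspace_wreath:
  "topspace (wreath_topology TYPE('p::prime_card)) = UNIV \<times> carrier (padic_int_group CARD('p))"
  by (simp add: wreath_topology_def topspace_padic_int_topology)

lemma loc_const_wreath:
  "loc_const (wreath_topology TYPE('p::prime_card)) (\<lambda>x. fst x $ k)"
  "loc_const (wreath_topology TYPE('p)) (\<lambda>x. snd x n)"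
proof -
  let ?T = "wreath_topology TYPE('p)"
  have "continuous_map ?T euclidean fst"
    unfolding wreath_topology_def by (rule continuous_map_fst)
  thus "loc_const ?T (\<lambda>x. fst x $ k)" by (simp add: continuous_map_fps_iff)
  have "continuous_map ?T (padic_int_topology CARD('p)) snd"
    unfolding wreath_topology_def by (rule continuous_map_snd)
  thus "loc_const ?T (\<lambda>x. snd x n)" by (simp add: continuous_map_padic_iff)
qed

text \<open>Both factors carry the topology of coordinatewise convergence with discrete
  coordinates.\<close>

lemma limitin_wreath:
  assumes "\<And>n. s n \<in> carrier (wreath TYPE('p::prime_card))" "z \<in> carrier (wreath TYPE('p))"
    and "\<And>k. eventually (\<lambda>n. fst (s n) $ k = fst z $ k) F"
    and "\<And>k. eventually (\<lambda>n. snd (s n) k = snd z k) F"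
  shows "limitin (wreath_topology TYPE('p)) s z F"
proof -
  have c: "a k \<in> carrier (integer_mod_group (CARD('p) ^ k))"
    if "a \<in> carrier (padic_int_group CARD('p))" for a k
    using that by (auto simp: padic_int_group_def Let_def PiE_iff)
  have sz: "snd (s n) \<in> carrier (padic_int_group CARD('p))" "snd z \<in> carrier (padic_int_group CARD('p))" for n
    using assms(1)[of n] assms(2) by (auto simp: wreath_simps)
  have "limitin (discrete_topology (carrier (integer_mod_group (CARD('p) ^ k)))) (\<lambda>n. snd (s n) k) (snd z k) F" for k
    unfolding limitin_def using c[OF sz(2)] assms(4)[of k] by (auto elim!: eventually_mono)
  hence "limitin (padic_int_topology CARD('p)) (\<lambda>n. snd (s n)) (snd z) F"
    unfolding padic_int_topology_def limitin_subtopology limitin_componentwise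
    using sz c by (simp add: PiE_iff)
  moreover have "((\<lambda>n. fst (s n)) \<longlongrightarrow> fst z) F"
    using assms(3) by (intro tendsto_fpsI)
  ultimately show ?thesis by (simp add: wreath_topology_def limitin_pairwise o_def)
qed

text \<open>The residue at level N fixes all lower residues, so the approximations chosen for
  growing N converge to z in every coordinate.\<close>

lemma in_closure_of_wreathI:
  assumes "K \<subseteq> carrier (wreath TYPE('p::prime_card))" "z \<in> carrier (wreath TYPE('p))"
    and "\<And>N. \<exists>y\<in>K. (\<forall>i<N. fst y $ i = fst z $ i) \<and> snd y N = snd z N"
  shows "z \<in> wreath_topology TYPE('p) closure_of K"
proof -
  from assms(3) obtain s where
    s: "\<And>N. s N \<in> K" "\<And>N i. i < N \<Longrightarrow> fst (s N) $ i = fst z $ i" "\<And>N. snd (s N) N = snd z N"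
    by metis
  have car: "snd (s N) \<in> carrier (padic_int_group CARD('p))" "snd z \<in> carrier (padic_int_group CARD('p))" for N
    using s(1)[of N] assms(1,2) by (auto simp: wreath_simps)
  have s4: "snd (s N) i = snd z i" if "i \<le> N" for N i
    using padic_mod[OF card_pos car(1)[of N] that] padic_mod[OF card_pos car(2) that] s(3)[of N] by simp
  have lim: "limitin (wreath_topology TYPE('p)) s z sequentially"
  proof (rule limitin_wreath)
    show "\<forall>\<^sub>F n in sequentially. fst (s n) $ k = fst z $ k" for k
      using eventually_gt_at_top[of k] by eventually_elim (rule s(2))
    show "\<forall>\<^sub>F n in sequentially. snd (s n) k = snd z k" for k
      using eventually_ge_at_top[of k] by eventually_elim (rule s4)
  qed (use s(1) assms in blast)+
  show ?thesis
  proof (rule limitin_closedin[OF lim closedin_closure_of])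
    have "K \<subseteq> wreath_topology TYPE('p) closure_of K"
      by (rule closure_of_subset) (use assms(1) in \<open>simp add: topspace_wreath wreath_simps\<close>)
    thus "\<forall>\<^sub>F n in sequentially. s n \<in> wreath_topology TYPE('p) closure_of K"
      using s(1) by (intro always_eventually) blast
  qed simp
qed

text \<open>Truncated multiples $hq$ are combinations of the $X^i h$ with coefficients in the prime field,
  which an additive set is automatically closed under.\<close>

lemma additive_X_closed_approx:
  fixes D :: "'p::prime_card mod_ring fps set"
  assumes zero: "0 \<in> D" and add: "\<And>f g. f \<in> D \<Longrightarrow> g \<in> D \<Longrightarrow> f + g \<in> D"
    and X: "\<And>f. f \<in> D \<Longrightarrow> fps_X * f \<in> D" and h: "h \<in> D"
  shows "\<exists>h'\<in>D. \<forall>i<N. h' $ i = (h * q) $ i"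
proof (induction N arbitrary: q)
  case 0
  show ?case using h by auto
next
  case (Suc N)
  \<comment> \<open>Horner step: h q = q(0) h + X (h q'), so N correct coefficients for h q' give N
    + 1 for h q. This is why q is generalized in the induction.\<close>
  define q' where "q' = Abs_fps (\<lambda>n. q $ Suc n)"
  have q: "q = fps_const (q $ 0) + fps_X * q'"
    by (rule fps_ext) (auto simp: q'_def)
  obtain h' where h': "h' \<in> D" "\<And>i. i < N \<Longrightarrow> h' $ i = (h * q') $ i" using Suc.IH[of q'] by blast
  have multiple: "of_nat n * h \<in> D" for n
    by (induction n) (auto simp: zero algebra_simps intro: add h)
  obtain n where "q $ 0 = of_nat n" using surj_of_nat_mod_ring by blast
  hence "fps_const (q $ 0) * h \<in> D" using multiple[of n] by (simp add: fps_of_nat)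
  hence "fps_const (q $ 0) * h + fps_X * h' \<in> D" using X h'(1) add by blast
  moreover have "(fps_const (q $ 0) * h + fps_X * h') $ i = (h * q) $ i" if "i < Suc N" for i
  proof -
    have "h * q = fps_const (q $ 0) * h + fps_X * (h * q')"
      by (subst q) (simp add: algebra_simps)
    thus ?thesis using that h'(2)[of "i - 1"] by (cases i) auto
  qed
  ultimately show ?case by blast
qed


section \<open>Generating pairs\<close>

lemma padic_commute: "a \<otimes>\<^bsub>padic_int_group p\<^esub> b = b \<otimes>\<^bsub>padic_int_group p\<^esub> a"
  by (simp add: padic_simps add.commute)

lemma wreath_commute_iff:
  "(f, a) \<otimes>\<^bsub>wreath TYPE('p::prime_card)\<^esub> (g, b) = (g, b) \<otimes>\<^bsub>wreath TYPE('p)\<^esub> (f, a) \<longleftrightarrow>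
     f + one_plus_X_pow a * g = g + one_plus_X_pow b * f"
  by (simp add: wreath_simps padic_commute)

text \<open>Two sequences tending to the identity eventually enter H. Commuting with (X^n, 0) forces
  (1+X)^a = 1, hence a = 0; commuting with (0, p^n) then forces f = 0, since (1+X)^(p^n) is not
  1.\<close>

lemma commute_open_imp_one:
  fixes W :: "('p::prime_card mod_ring fps \<times> (nat \<Rightarrow> int)) monoid"
  defines "W \<equiv> wreath TYPE('p)"
  assumes H: "openin (wreath_topology TYPE('p)) H" "\<one>\<^bsub>W\<^esub> \<in> H"
    and x: "x \<in> carrier W" "\<And>z. z \<in> H \<Longrightarrow> x \<otimes>\<^bsub>W\<^esub> z = z \<otimes>\<^bsub>W\<^esub> x"
  shows "x = \<one>\<^bsub>W\<^esub>"
proof -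
  let ?p = "CARD('p)" and ?T = "wreath_topology TYPE('p)"
  obtain f a where xfa: "x = (f, a)" by fastforce
  have a: "a \<in> carrier (padic_int_group ?p)"
    using x(1) by (simp add: W_def wreath_simps xfa)
  have zero: "(\<lambda>_. 0) \<in> carrier (padic_int_group ?p)"
    by (simp add: carrier_padic_int_group card_pos)
  have "limitin ?T (\<lambda>n. (fps_X ^ n, \<lambda>_. 0)) \<one>\<^bsub>W\<^esub> sequentially"
    unfolding W_def
  proof (rule limitin_wreath)
    show "\<forall>\<^sub>F n in sequentially. fst (fps_X ^ n :: 'p mod_ring fps, \<lambda>_. 0 :: int) $ k = fst \<one>\<^bsub>wreath TYPE('p)\<^esub> $ k" for k
      using eventually_gt_at_top[of k] by eventually_elim (simp add: wreath_simps fps_X_power_nth)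
  qed (simp_all add: wreath_simps zero)
  with H have "\<forall>\<^sub>F n in sequentially. (fps_X ^ n, \<lambda>_. 0) \<in> H" by (simp add: limitin_def)
  then obtain n where "(fps_X ^ n, \<lambda>_. 0) \<in> H" by (auto dest: eventually_happens)
  from x(2)[OF this] have "f + one_plus_X_pow a * fps_X ^ n = fps_X ^ n + one_plus_X_pow (\<lambda>_. 0) * f"
    by (simp only: W_def xfa wreath_commute_iff)
  hence "one_plus_X_pow a * fps_X ^ n = (1 :: 'p mod_ring fps) * fps_X ^ n"
    by (simp add: one_plus_X_pow_0)
  hence "one_plus_X_pow a = (1 :: 'p mod_ring fps)" by (simp only: mult_cancel_right) simp
  hence a0: "a = (\<lambda>_. 0)" by (rule one_plus_X_pow_eq_1D[OF a])
  let ?t = "\<lambda>n. padic_of_nat ?p (?p ^ n)"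
  have "limitin ?T (\<lambda>n. (0, ?t n)) \<one>\<^bsub>W\<^esub> sequentially"
    unfolding W_def
  proof (rule limitin_wreath)
    show "\<forall>\<^sub>F n in sequentially. snd (0 :: 'p mod_ring fps, ?t n) k = snd \<one>\<^bsub>wreath TYPE('p)\<^esub> k" for k
      using eventually_ge_at_top[of k]
      by eventually_elim (simp add: wreath_simps padic_of_nat_def le_imp_power_dvd)
  qed (simp_all add: wreath_simps zero padic_of_nat_carrier card_pos)
  with H have "\<forall>\<^sub>F n in sequentially. (0, ?t n) \<in> H" by (simp add: limitin_def)
  then obtain n where "(0, ?t n) \<in> H" by (auto dest: eventually_happens)
  from x(2)[OF this] have "f + one_plus_X_pow a * 0 = 0 + one_plus_X_pow (?t n) * f"
    by (simp only: W_def xfa wreath_commute_iff)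
  hence "f = 0 \<or> one_plus_X_pow (?t n) = (1 :: 'p mod_ring fps)" by simp
  moreover have "one_plus_X_pow (?t n) \<noteq> (1 :: 'p mod_ring fps)"
  proof
    assume "one_plus_X_pow (?t n) = (1 :: 'p mod_ring fps)"
    hence "?t n = (\<lambda>_. 0)" by (rule one_plus_X_pow_eq_1D[OF padic_of_nat_carrier[OF card_pos]])
    \<comment> \<open>The residue of p^n modulo p^(n+1) is p^n itself, which is not 0.\<close>
    hence "?t n (Suc n) = 0" by simp
    moreover have "?p > 1" using prime_card[where 'a='p] by (rule prime_gt_1_nat)
    ultimately show False by (simp add: padic_of_nat_def)
  qed
  ultimately show ?thesis by (simp add: W_def wreath_simps xfa a0)
qed

lemma not_virt_generates_commuting:
  fixes W :: "('p::prime_card mod_ring fps \<times> (nat \<Rightarrow> int)) monoid"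
  defines "W \<equiv> wreath TYPE('p)"
  assumes xy: "x \<in> carrier W" "y \<in> carrier W" and comm: "x \<otimes>\<^bsub>W\<^esub> y = y \<otimes>\<^bsub>W\<^esub> x"
  shows "\<not> virt_generates W (wreath_topology TYPE('p)) x y"
proof
  let ?T = "wreath_topology TYPE('p)"
  interpret W: topological_group W ?T unfolding W_def by (rule topological_group_wreath)
  define K where "K = generate W {x, y}"
  have Kc: "K \<subseteq> carrier W" unfolding K_def using xy by (intro W.generate_incl) auto
  assume "virt_generates W ?T x y"
  hence op: "openin ?T (?T closure_of K)" by (simp add: virt_generates_def top_generate_def K_def)
  have "K \<subseteq> ?T closure_of K" by (rule closure_of_subset) (use Kc W.topspace_eq in simp)
  moreover have "\<one>\<^bsub>W\<^esub> \<in> K" unfolding K_def by (rule generate.one)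
  ultimately have one: "\<one>\<^bsub>W\<^esub> \<in> ?T closure_of K" by blast
  \<comment> \<open>The centralizer of K is trivial, because it also centralizes the closure of K,
    which is open by assumption.\<close>
  have trivial: "w = \<one>\<^bsub>W\<^esub>" if w: "w \<in> carrier W" "\<And>z. z \<in> K \<Longrightarrow> w \<otimes>\<^bsub>W\<^esub> z = z \<otimes>\<^bsub>W\<^esub> w" for w
  proof -
    obtain f a where wfa: "w = (f, a)" by fastforce
    \<comment> \<open>The exponents of wz and zw always agree, so commutation is the vanishing of
      \<open>?d z\<close>, the difference of the power series components. Its coefficients are
      locally constant in z.\<close>
    let ?d = "\<lambda>z. f + one_plus_X_pow a * fst z - (fst z + one_plus_X_pow (snd z) * f)"
    have iff: "w \<otimes>\<^bsub>W\<^esub> z = z \<otimes>\<^bsub>W\<^esub> w \<longleftrightarrow> (\<forall>k. ?d z $ k = 0)" for z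
    proof -
      have "w \<otimes>\<^bsub>W\<^esub> z = z \<otimes>\<^bsub>W\<^esub> w \<longleftrightarrow> f + one_plus_X_pow a * fst z = fst z + one_plus_X_pow (snd z) * f"
        unfolding W_def wfa using wreath_commute_iff[of f a "fst z" "snd z"] by simp
      also have "\<dots> \<longleftrightarrow> ?d z = 0" by simp
      finally show ?thesis by (simp only: fps_eq_iff fps_zero_nth)
    qed
    have const: "loc_const ?T (\<lambda>z. c $ k)" for c :: "'p mod_ring fps" and k
      by (simp add: loc_const_def)
    have pow: "loc_const ?T (\<lambda>z. (one_plus_X_pow (snd z) :: 'p mod_ring fps) $ k)" for k
      by (rule loc_const_one_plus_X_pow[OF _ loc_const_wreath(2)]) (auto simp: topspace_wreath)
    have d: "loc_const ?T (\<lambda>z. ?d z $ k)" for k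
    proof -
      have 1: "loc_const ?T (\<lambda>z. (one_plus_X_pow a * fst z) $ k)"
        by (rule loc_const_fps_mult[OF const loc_const_wreath(1)])
      have 2: "loc_const ?T (\<lambda>z. (one_plus_X_pow (snd z) * f) $ k)"
        by (rule loc_const_fps_mult[OF pow const])
      have 3: "loc_const ?T (\<lambda>z. fst z $ k + (one_plus_X_pow (snd z) * f) $ k)"
        by (rule loc_const_map2[OF loc_const_wreath(1) 2])
      have "loc_const ?T (\<lambda>z. (f $ k + (one_plus_X_pow a * fst z) $ k) -
            (fst z $ k + (one_plus_X_pow (snd z) * f) $ k))"
        by (rule loc_const_map2[OF loc_const_map[OF 1] 3])
      thus ?thesis by (simp only: fps_add_nth fps_sub_nth)
    qed
    have "w \<otimes>\<^bsub>W\<^esub> z = z \<otimes>\<^bsub>W\<^esub> w" if "z \<in> ?T closure_of K" for z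
      unfolding iff
    proof
      fix k
      show "?d z $ k = 0"
        by (rule loc_const_closure_of[OF d _ that]) (use w(2) iff in blast)
    qed
    with commute_open_imp_one[OF op one[unfolded W_def], of w] w(1) show ?thesis
      unfolding W_def by blast
  qed
  have cx: "x \<otimes>\<^bsub>W\<^esub> z = z \<otimes>\<^bsub>W\<^esub> x" if "z \<in> K" for z
    by (rule W.commute_generate[of x "{x, y}"]) (use xy comm that in \<open>auto simp: K_def\<close>)
  have cy: "y \<otimes>\<^bsub>W\<^esub> z = z \<otimes>\<^bsub>W\<^esub> y" if "z \<in> K" for z
    by (rule W.commute_generate[of y "{x, y}"]) (use xy comm that in \<open>auto simp: K_def\<close>)
  \<comment> \<open>First x and y are trivial since they centralize K, so K is trivial. Then every
    element centralizes K, and (1, 0) gives the contradiction.\<close>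
  have "x = \<one>\<^bsub>W\<^esub>" "y = \<one>\<^bsub>W\<^esub>" using trivial xy cx cy by blast+
  hence K1: "K = {\<one>\<^bsub>W\<^esub>}" using W.generate_one by (simp add: K_def)
  have "(1, \<lambda>_. 0) \<in> carrier W" "(1, \<lambda>_. 0) \<noteq> \<one>\<^bsub>W\<^esub>"
    by (simp_all add: W_def wreath_simps carrier_padic_int_group card_pos)
  with trivial[of "(1, \<lambda>_. 0)"] show False unfolding K1 by simp
qed

text \<open>The commutator of the two elements is $(h_0, 0)$ with $h_0 \neq 0$. Conjugation by the second
  element acts on the base group as multiplication by $1 + X$, so the closure contains the ideal
  $(h_0) = (X^m)$ of the base group, and together with the powers of the second element it
  contains $(X^m) \times p^k \mathbb{Z}_p$ as soon as $p^k > m$.\<close>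

lemma virt_generates_noncommuting:
  fixes W :: "('p::prime_card mod_ring fps \<times> (nat \<Rightarrow> int)) monoid"
    and g :: "'p mod_ring fps"
  defines "W \<equiv> wreath TYPE('p)" and "y \<equiv> (g, padic_of_nat CARD('p) 1)"
  assumes x: "x \<in> carrier W" and noncomm: "x \<otimes>\<^bsub>W\<^esub> y \<noteq> y \<otimes>\<^bsub>W\<^esub> x"
  shows "virt_generates W (wreath_topology TYPE('p)) x y"
proof -
  let ?p = "CARD('p)" and ?T = "wreath_topology TYPE('p)"
  let ?\<iota> = "padic_of_nat ?p" and ?z = "\<lambda>_::nat. 0::int" and ?Y = "1 + fps_X :: 'p mod_ring fps"
  interpret W: topological_group W ?T unfolding W_def by (rule topological_group_wreath)
  interpret Zp: group "padic_int_group ?p" by (rule group_padic_int_group[OF card_pos])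
  have l_one: "?z \<otimes>\<^bsub>padic_int_group ?p\<^esub> b = b" if "b \<in> carrier (padic_int_group ?p)" for b
    using Zp.l_one[OF that] by (simp only: padic_simps(1))
  have \<iota>c: "?\<iota> n \<in> carrier (padic_int_group ?p)" for n
    by (rule padic_of_nat_carrier[OF card_pos])
  have zc: "?z \<in> carrier (padic_int_group ?p)"
    by (simp add: carrier_padic_int_group card_pos)
  have y: "y \<in> carrier W" by (simp add: W_def y_def wreath_simps \<iota>c)
  obtain f a where xfa: "x = (f, a)" by fastforce
  have a: "a \<in> carrier (padic_int_group ?p)"
    using x by (simp add: W_def wreath_simps xfa)
  define K where "K = generate W {x, y}"
  have K: "subgroup K W" unfolding K_def using x y by (intro W.generate_is_subgroup) auto
  interpret K: subgroup K W by (rule K)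
  have xK: "x \<in> K" and yK: "y \<in> K" by (simp_all add: K_def generate.incl)

  \<comment> \<open>The part of K in the base group. K need not be closed, so D is only shown to be
    closed under addition, negation and multiplication by X; the full ideal of \<open>h0\<close> is
    reached in the closure.\<close>
  define D where "D = {h. (h, ?z) \<in> K}"
  have D0: "0 \<in> D" using K.one_closed by (simp add: D_def W_def wreath_simps)
  have Dadd: "h + h' \<in> D" if "h \<in> D" "h' \<in> D" for h h'
  proof -
    have "(h, ?z) \<otimes>\<^bsub>W\<^esub> (h', ?z) \<in> K" using that by (simp add: D_def)
    thus ?thesis by (simp add: D_def W_def wreath_simps l_one zc one_plus_X_pow_0)
  qed
  have Dneg: "- h \<in> D" if "h \<in> D" for h
  proof -
    have "inv\<^bsub>W\<^esub> (h, ?z) \<in> K" using that by (simp add: D_def)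
    moreover have "inv\<^bsub>W\<^esub> (h, ?z) = (- h, ?z)"
      by (rule W.inv_equality) (simp_all add: W_def wreath_simps l_one zc one_plus_X_pow_0)
    ultimately show ?thesis by (simp add: D_def)
  qed
  have DX: "fps_X * h \<in> D" if "h \<in> D" for h
  proof -
    have "y \<otimes>\<^bsub>W\<^esub> (h, ?z) = (?Y * h, ?z) \<otimes>\<^bsub>W\<^esub> y"
      using one_plus_X_pow_of_nat[where 'p='p, of 1]
      by (simp add: W_def y_def wreath_simps one_plus_X_pow_0 padic_commute[of _ "?\<iota> _"] add.commute)
    moreover have "(?Y * h, ?z) \<in> carrier W" by (simp add: W_def wreath_simps zc)
    ultimately have "(?Y * h, ?z) = y \<otimes>\<^bsub>W\<^esub> (h, ?z) \<otimes>\<^bsub>W\<^esub> inv\<^bsub>W\<^esub> y"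
      using y by (simp add: W.m_assoc)
    moreover have "\<dots> \<in> K" using that yK by (simp add: D_def)
    ultimately have "?Y * h \<in> D" by (simp add: D_def)
    \<comment> \<open>Subtracting h from its conjugate (1 + X) h leaves X h.\<close>
    from Dadd[OF this Dneg[OF that]] show ?thesis by (simp add: algebra_simps)
  qed

  define h0 where "h0 = f + one_plus_X_pow a * g - (g + ?Y * f)"
  have h0: "h0 \<noteq> 0"
    using noncomm one_plus_X_pow_of_nat[where 'p='p, of 1]
    unfolding W_def xfa y_def wreath_commute_iff h0_def by simp
  have h0D: "h0 \<in> D"
  proof -
    have "x \<otimes>\<^bsub>W\<^esub> y = (h0, ?z) \<otimes>\<^bsub>W\<^esub> (y \<otimes>\<^bsub>W\<^esub> x)"
      using one_plus_X_pow_of_nat[where 'p='p, of 1]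
      by (simp add: W_def xfa y_def wreath_simps one_plus_X_pow_0 h0_def l_one Zp.m_closed \<iota>c a
          padic_commute[of _ a])
    moreover have "(h0, ?z) \<in> carrier W" by (simp add: W_def wreath_simps zc)
    ultimately have "(h0, ?z) = x \<otimes>\<^bsub>W\<^esub> y \<otimes>\<^bsub>W\<^esub> inv\<^bsub>W\<^esub> (y \<otimes>\<^bsub>W\<^esub> x)"
      using x y by (simp add: W.m_assoc)
    moreover have "\<dots> \<in> K" using xK yK by simp
    ultimately show ?thesis by (simp add: D_def)
  qed

  \<comment> \<open>These are the powers y^n: passing from n to n + 1 adds (1+X)^n g to the base
    component.\<close>
  have powers: "(g * (\<Sum>i<n. ?Y ^ i), ?\<iota> n) \<in> K" for n
  proof (induction n)
    case 0
    have "?\<iota> 0 = ?z" by (simp add: padic_of_nat_def)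
    thus ?case using D0 by (simp add: D_def)
  next
    case (Suc n)
    have "(g * (\<Sum>i<n. ?Y ^ i), ?\<iota> n) \<otimes>\<^bsub>W\<^esub> y = (g * (\<Sum>i<Suc n. ?Y ^ i), ?\<iota> (Suc n))"
      by (simp add: W_def y_def wreath_simps one_plus_X_pow_of_nat padic_of_nat_add algebra_simps)
    thus ?case using K.m_closed[OF Suc yK] by simp
  qed

  define m where "m = subdegree h0"
  \<comment> \<open>This choice gives m < k < p^k.\<close>
  define k where "k = Suc m"
  \<comment> \<open>X times the geometric sum is (1+X)^n - 1, and (1+X)^n agrees with 1 in all
    coefficients below p^k. So the base component of y^n lies in (X^m) when p^k divides n.\<close>
  have geometric: "(g * (\<Sum>i<n. ?Y ^ i)) $ j = 0" if n: "?p ^ k dvd n" and "j < m" for n j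
  proof -
    have "(\<Sum>i<n. ?Y ^ i) $ l = 0" if "l < m" for l
    proof -
      have "(\<Sum>i<n. ?Y ^ i) $ l = (fps_X * (\<Sum>i<n. ?Y ^ i)) $ Suc l" by simp
      also have "fps_X * (\<Sum>i<n. ?Y ^ i) = ?Y ^ n - 1"
        using power_diff_1_eq[of ?Y n] by simp
      also have "(?Y ^ n - 1) $ Suc l = (?Y ^ n) $ Suc l - (?Y ^ 0) $ Suc l" by simp
      also have "(?Y ^ n) $ Suc l = (?Y ^ 0) $ Suc l"
      proof (rule one_plus_X_power_cong)
        show "[n = 0] (mod ?p ^ k)" using n by (simp add: cong_0_iff)
        show "Suc l < ?p ^ k" using less_card_power[of k, where 'p='p] \<open>l < m\<close> by (simp add: k_def)
      qed
      finally show ?thesis by simp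
    qed
    thus ?thesis using \<open>j < m\<close> by (simp add: fps_mult_nth)
  qed

  define U where "U = {w \<in> topspace ?T. (\<forall>i<m. fst w $ i = 0) \<and> snd w k = 0}"
  have "openin ?T U"
  proof -
    \<comment> \<open>The factor \<open>topspace ?T\<close> matters for m = 0, where the
      intersection over the empty index set is the whole type.\<close>
    have "U = ((\<Inter>i\<in>{..<m}. {w \<in> topspace ?T. fst w $ i = 0}) \<inter> topspace ?T) \<inter>
        {w \<in> topspace ?T. snd w k = 0}"
      by (auto simp: U_def)
    thus ?thesis
      by (auto intro!: openin_Int openin_INT openin_loc_const loc_const_wreath)
  qed
  moreover have "\<one>\<^bsub>W\<^esub> \<in> U" by (simp add: U_def topspace_wreath W_def wreath_simps zc)
  moreover have "U \<subseteq> ?T closure_of K"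
  proof
    fix w assume "w \<in> U"
    moreover obtain h b where w: "w = (h, b)" by fastforce
    ultimately have b: "b \<in> carrier (padic_int_group ?p)" "b k = 0"
      and h: "\<And>i. i < m \<Longrightarrow> h $ i = 0"
      by (auto simp: U_def topspace_wreath)
    have "\<exists>v\<in>K. (\<forall>i<N. fst v $ i = fst w $ i) \<and> snd v N = snd w N" for N
    proof -
      \<comment> \<open>Level M decides both the target residue at level N and divisibility by p^k.
        The exponent n then approximates b, and y^n has base component s with h - s in the ideal of
        \<open>h0\<close>.\<close>
      define M where "M = max N k"
      define n where "n = nat (b M)"
      have "0 \<le> b M" using b(1) by (simp add: carrier_padic_int_group card_pos)
      hence n: "int n = b M" by (simp add: n_def)
      have "int n mod int (?p ^ k) = 0"
        using padic_mod[OF card_pos b(1), of k M] b(2) by (simp add: n M_def)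
      hence pn: "?p ^ k dvd n" by (metis dvd_eq_mod_eq_0 of_nat_dvd_iff)
      define s where "s = g * (\<Sum>i<n. ?Y ^ i)"
      have "h0 dvd h - s"
      proof (cases "h - s = 0")
        case False
        have "m \<le> subdegree (h - s)"
          using False by (intro subdegree_geI) (simp_all add: h s_def geometric[OF pn] del: fps_mult_nth)
        thus ?thesis using fps_dvd_iff[OF h0 False] by (simp add: m_def)
      qed simp
      then obtain q where q: "h - s = h0 * q" by (elim dvdE)
      obtain h1 where h1: "h1 \<in> D" "\<And>i. i < N \<Longrightarrow> h1 $ i = (h0 * q) $ i"
        using additive_X_closed_approx[OF D0 Dadd DX h0D] by blast
      have "(h1, ?z) \<otimes>\<^bsub>W\<^esub> (s, ?\<iota> n) \<in> K"
        using h1(1) powers[of n] by (simp add: D_def s_def)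
      hence "(h1 + s, ?\<iota> n) \<in> K" by (simp add: W_def wreath_simps one_plus_X_pow_0 l_one \<iota>c)
      moreover have "(h1 + s) $ i = h $ i" if "i < N" for i
        using h1(2)[OF that] by (simp add: q[symmetric])
      moreover have "?\<iota> n N = b N"
        using padic_mod[OF card_pos b(1), of N M] by (simp add: padic_of_nat_def n M_def)
      ultimately show ?thesis unfolding w by (intro bexI[of _ "(h1 + s, ?\<iota> n)"]) auto
    qed
    moreover have "w \<in> carrier (wreath TYPE('p))" by (simp add: w wreath_simps b)
    moreover have "K \<subseteq> carrier (wreath TYPE('p))" using K.subset by (simp add: W_def)
    ultimately show "w \<in> ?T closure_of K" by (intro in_closure_of_wreathI)
  qed
  ultimately show ?thesis
    unfolding virt_generates_def top_generate_def K_def[symmetric]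
    by (intro W.openin_closure_of_subgroup[OF K])
qed

text \<open>Two elements $(g, 1)$ and $(g', 1)$ with $g \neq g'$ both commute with $x$ only if $x = 1$, so
  each of $x$ and $x'$ rules out at most one of the three candidates $g = 0, 1, X$.\<close>

lemma common_neighbour:
  fixes W :: "('p::prime_card mod_ring fps \<times> (nat \<Rightarrow> int)) monoid"
  defines "W \<equiv> wreath TYPE('p)"
  assumes x: "x \<in> carrier W" "x \<noteq> \<one>\<^bsub>W\<^esub>" and x': "x' \<in> carrier W" "x' \<noteq> \<one>\<^bsub>W\<^esub>"
  obtains y where "y \<in> carrier W" "y \<noteq> \<one>\<^bsub>W\<^esub>" "y \<noteq> x" "y \<noteq> x'"
    "virt_generates W (wreath_topology TYPE('p)) x y"
    "virt_generates W (wreath_topology TYPE('p)) x' y"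
proof -
  interpret W: group W unfolding W_def by (rule group_wreath)
  let ?y = "\<lambda>g :: 'p mod_ring fps. (g, padic_of_nat CARD('p) 1)"
  have unique: "g = g'"
    if x: "x \<in> carrier W" "x \<noteq> \<one>\<^bsub>W\<^esub>"
      and g: "x \<otimes>\<^bsub>W\<^esub> ?y g = ?y g \<otimes>\<^bsub>W\<^esub> x" "x \<otimes>\<^bsub>W\<^esub> ?y g' = ?y g' \<otimes>\<^bsub>W\<^esub> x" for x g g'
  proof -
    obtain f a where xfa: "x = (f, a)" by fastforce
    have a: "a \<in> carrier (padic_int_group CARD('p))"
      using x by (simp add: W_def wreath_simps xfa)
    have "f + one_plus_X_pow a * g = g + (1 + fps_X) * f" "f + one_plus_X_pow a * g' = g' + (1 + fps_X) * f"
      using g one_plus_X_pow_of_nat[where 'p='p, of 1] unfolding W_def xfa wreath_commute_iff by simp_all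
    \<comment> \<open>Commuting with (g, 1) is a linear equation for g over a domain. The solution
      is unique unless (1+X)^a - 1 vanishes; in that case a = 0 and f = 0, so x would be
      trivial.\<close>
    hence eq: "(one_plus_X_pow a - 1) * g = fps_X * f" "(one_plus_X_pow a - 1) * g' = fps_X * f"
      by (simp_all add: algebra_simps)
    show ?thesis
    proof (cases "one_plus_X_pow a = (1 :: 'p mod_ring fps)")
      case True
      hence "f = 0" using eq by simp
      moreover have "a = (\<lambda>_. 0)" by (rule one_plus_X_pow_eq_1D[OF a True])
      ultimately show ?thesis using x(2) by (simp add: xfa W_def wreath_simps)
    next
      case False
      have "(one_plus_X_pow a - 1) * g = (one_plus_X_pow a - 1) * g'" using eq by simp
      thus ?thesis using False by simp
    qed
  qed
  \<comment> \<open>With X as third candidate, three distinct ones exist even for p = 2, where 0 and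
    1 are the only constants.\<close>
  have ne: "(0 :: 'p mod_ring fps) \<noteq> 1" "(0 :: 'p mod_ring fps) \<noteq> fps_X" "(1 :: 'p mod_ring fps) \<noteq> fps_X"
    by simp_all
  obtain g where g: "x \<otimes>\<^bsub>W\<^esub> ?y g \<noteq> ?y g \<otimes>\<^bsub>W\<^esub> x" "x' \<otimes>\<^bsub>W\<^esub> ?y g \<noteq> ?y g \<otimes>\<^bsub>W\<^esub> x'"
  proof -
    define P where "P = (\<lambda>x g. x \<otimes>\<^bsub>W\<^esub> ?y g = ?y g \<otimes>\<^bsub>W\<^esub> x)"
    have "P x g \<Longrightarrow> P x h \<Longrightarrow> g = h" "P x' g \<Longrightarrow> P x' h \<Longrightarrow> g = h" for g h
      unfolding P_def by (rule unique[OF x]; assumption) (rule unique[OF x']; assumption)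
    hence "\<exists>g \<in> {0, 1, fps_X}. \<not> P x g \<and> \<not> P x' g" using ne by blast
    thus ?thesis using that unfolding P_def by blast
  qed
  show ?thesis
  proof (rule that[of "?y g"])
    show "?y g \<in> carrier W" by (simp add: W_def wreath_simps padic_of_nat_carrier card_pos)
    \<comment> \<open>An element commuting with neither x nor x' differs from both and from the
      identity.\<close>
    show "?y g \<noteq> \<one>\<^bsub>W\<^esub>" "?y g \<noteq> x" "?y g \<noteq> x'" using g x x' by auto
    show "virt_generates W (wreath_topology TYPE('p)) x (?y g)"
      "virt_generates W (wreath_topology TYPE('p)) x' (?y g)"
      using virt_generates_noncommuting x x' g unfolding W_def by blast+
  qed
qed


section \<open>Isolated vertices and diameter\<close>

text \<open>The cost of a walk is its length here; an empty walk would give u = v, and a walk of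
  length 1 would be an arc from u to v.\<close>

lemma (in wf_digraph) unit_cost_ge_2:
  assumes "u \<noteq> v" "(u, v) \<notin> arcs_ends G"
  shows "2 \<le> \<mu> (\<lambda>_. 1) u v"
  unfolding \<mu>_def
proof (rule INF_greatest)
  fix p assume "p \<in> {p. awalk u p v}"
  hence p: "awalk u p v" by simp
  have "length p \<ge> 2"
  proof (rule ccontr)
    assume "\<not> length p \<ge> 2"
    then consider "p = []" | e where "p = [e]"
      by (cases p; cases "tl p") auto
    thus False
      using p assms by cases (auto simp: awalk_simps arcs_ends_conv)
  qed
  moreover have "awalk_cost (\<lambda>_. 1) p = length p"
    by (simp add: awalk_cost_def sum_list_triv)
  ultimately show "2 \<le> ereal (awalk_cost (\<lambda>_. 1) p)" by simp
qed

text \<open>The identity commutes with everything; any other x has a neighbour by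
  \<open>common_neighbour\<close> with both elements equal to x.\<close>

lemma virt_isolated_wreath:
  "virt_isolated (wreath TYPE('p::prime_card)) (wreath_topology TYPE('p)) = {\<one>\<^bsub>wreath TYPE('p)\<^esub>}"
proof -
  let ?W = "wreath TYPE('p)" and ?T = "wreath_topology TYPE('p)"
  interpret W: group ?W by (rule group_wreath)
  have "\<not> virt_generates ?W ?T \<one>\<^bsub>?W\<^esub> y" if "y \<in> carrier ?W" for y
    by (rule not_virt_generates_commuting) (use that in simp_all)
  moreover have "\<exists>y\<in>carrier ?W. virt_generates ?W ?T x y" if "x \<in> carrier ?W" "x \<noteq> \<one>\<^bsub>?W\<^esub>" for x
    by (rule common_neighbour[OF that that]) blast
  ultimately show ?thesis unfolding virt_isolated_def using W.one_closed by blast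
qed

theorem proposition7p2:
  shows "let W = wreath TYPE('p::prime_card); T = wreath_topology TYPE('p);
             \<Gamma> = virt_graph W T; \<Delta> = proper_virt_graph W T
         in virt_isolated W T = {\<one>\<^bsub>W\<^esub>} \<and>
            \<Delta> = pre_digraph.del_vert \<Gamma> \<one>\<^bsub>W\<^esub> \<and>
            Digraph_Component.connected \<Delta> \<and>
            graph_diameter \<Delta> = 2"
proof -
  let ?W = "wreath TYPE('p)" and ?T = "wreath_topology TYPE('p)"
  define \<Delta> where "\<Delta> = proper_virt_graph ?W ?T"
  interpret W: group ?W by (rule group_wreath)
  interpret \<Delta>: wf_digraph \<Delta> unfolding \<Delta>_def by (rule wf_digraph_proper_virt_graph)
  have verts: "verts \<Delta> = carrier ?W - {\<one>\<^bsub>?W\<^esub>}"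
    by (simp add: \<Delta>_def proper_virt_graph_def virt_isolated_wreath)
  have arcs: "arcs \<Delta> = {(x, y). x \<in> verts \<Delta> \<and> y \<in> verts \<Delta> \<and> x \<noteq> y \<and> virt_generates ?W ?T x y}"
    unfolding verts by (auto simp: \<Delta>_def proper_virt_graph_def virt_isolated_wreath virt_graph_simps)
  have ends: "tail \<Delta> = fst" "head \<Delta> = snd"
    by (simp_all add: \<Delta>_def proper_virt_graph_def virt_graph_simps)
  have del: "\<Delta> = pre_digraph.del_vert (virt_graph ?W ?T) \<one>\<^bsub>?W\<^esub>"
    by (rule pre_digraph.equality)
      (auto simp: verts arcs ends pre_digraph.del_vert_def virt_graph_simps)
  \<comment> \<open>The case u = v is included, with a walk to y and back, so one bound covers all
    pairs of vertices.\<close>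
  have walk: "\<exists>y. \<Delta>.awalk u [(u, y), (y, v)] v" if "u \<in> verts \<Delta>" "v \<in> verts \<Delta>" for u v
  proof -
    have "u \<in> carrier ?W" "u \<noteq> \<one>\<^bsub>?W\<^esub>" "v \<in> carrier ?W" "v \<noteq> \<one>\<^bsub>?W\<^esub>"
      using that by (auto simp: verts)
    then obtain y where y: "y \<in> verts \<Delta>" "y \<noteq> u" "y \<noteq> v"
      "virt_generates ?W ?T u y" "virt_generates ?W ?T v y"
      unfolding verts by (rule common_neighbour) auto
    hence "\<Delta>.awalk u [(u, y), (y, v)] v"
      using that virt_generates_commute[of ?W ?T] by (auto simp: \<Delta>.awalk_simps arcs ends)
    thus ?thesis ..
  qed
  let ?f = "(1, \<lambda>_. 0) :: 'p mod_ring fps \<times> (nat \<Rightarrow> int)"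
  let ?g = "(fps_X, \<lambda>_. 0) :: 'p mod_ring fps \<times> (nat \<Rightarrow> int)"
  have fg: "?f \<in> verts \<Delta>" "?g \<in> verts \<Delta>" "?f \<noteq> ?g"
    by (simp_all add: verts wreath_simps carrier_padic_int_group card_pos)
  have "connected \<Delta>"
    unfolding connected_def
  proof (rule strongly_connectedI)
    show "verts (with_proj (mk_symmetric \<Delta>)) \<noteq> {}" using fg(1) by auto
    fix u v assume "u \<in> verts (with_proj (mk_symmetric \<Delta>))" "v \<in> verts (with_proj (mk_symmetric \<Delta>))"
    hence "u \<in> verts \<Delta>" "v \<in> verts \<Delta>" by simp_all
    from walk[OF this] have "u \<rightarrow>\<^sup>*\<^bsub>\<Delta>\<^esub> v" by (auto simp: \<Delta>.reachable_awalk)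
    thus "u \<rightarrow>\<^sup>*\<^bsub>with_proj (mk_symmetric \<Delta>)\<^esub> v" by (rule \<Delta>.reachable_mk_symmetricI)
  qed
  moreover have "graph_diameter \<Delta> = 2"
  proof (rule antisym)
    have "\<Delta>.\<mu> (\<lambda>_. 1) u v \<le> 2" if uv: "u \<in> verts \<Delta>" "v \<in> verts \<Delta>" for u v
    proof -
      obtain y where "\<Delta>.awalk u [(u, y), (y, v)] v" using walk[OF uv] ..
      from \<Delta>.min_cost_le_walk_cost[OF this, of "\<lambda>_. 1"] show ?thesis by simp
    qed
    thus "graph_diameter \<Delta> \<le> 2" unfolding graph_diameter_def by (intro SUP_least)
    have "\<not> virt_generates ?W ?T ?f ?g"
      by (rule not_virt_generates_commuting)
        (use fg in \<open>auto simp: verts wreath_commute_iff one_plus_X_pow_0\<close>)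
    hence "(?f, ?g) \<notin> arcs_ends \<Delta>" by (auto simp: arcs_ends_conv arcs ends)
    hence "2 \<le> \<Delta>.\<mu> (\<lambda>_. 1) ?f ?g" by (rule \<Delta>.unit_cost_ge_2[OF fg(3)])
    also have "\<dots> \<le> graph_diameter \<Delta>"
      unfolding graph_diameter_def by (intro SUP_upper2[OF fg(1)] SUP_upper fg(2))
    finally show "2 \<le> graph_diameter \<Delta>" .
  qed
  ultimately show ?thesis
    using del virt_isolated_wreath[where 'p='p] by (simp add: Let_def \<Delta>_def)
qed

end
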